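(* Let $\Delta$ be an additive subgroup of $\mathbb{C}$, let $b\in\mathbb{C}$ with $b\notin\Delta$, and let $\mathcal{A}=\mathcal{A}_{\Delta,\mathbb{N}}$ be the complex vector space with basis $\{x_{\alpha,i}\mid\alpha\in\Delta,\,i\in\mathbb{N}\}$ and Novikov product $$x_{\alpha,i}\circ x_{\beta,j}=(\beta+b)x_{\alpha+\beta,i+j}+j\,x_{\alpha+\beta,i+j-1}\qquad\text{for }\alpha,\beta\in\Delta,\ i,j\in\mathbb{N}.$$ A bilinear operation $[\cdot,\cdot]$ on $\mathcal{A}$ makes $(\mathcal{A},[\cdot,\cdot])$ a Lie algebra over the Novikov algebra $(\mathcal{A},\circ)$ if and only if it has the form $$[x_{\alpha,i},x_{\beta,j}]=\frac1b\big((\alpha+b)\varphi(\beta)-(\beta+b)\varphi(\alpha)\big)x_{\alpha+\beta,i+j}+\frac1b\big[i(\varphi(\beta)-\lambda(\beta+b))+j(\lambda(\alpha+b)-\varphi(\alpha))\big]x_{\alpha+\beta,i+j-1}$$ for $\alpha,\beta\in\Delta$, $i,j\in\mathbb{N}$, where $\varphi:\Delta\to\mathbb{C}$ is a homomorphism of additive groups and $\lambda\in\mathbb{C}$ is a constant.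
   Context: $\mathbb{N}=\{0,1,2,\dots\}$, and $x_{\alpha,-1}$ is interpreted as $0$. A Novikov algebra $(\mathcal{A},\circ)$ (over $\mathbb{C}$) satisfies $(u\circ v)\circ w=(u\circ w)\circ v$ and $(u,v,w)=(v,u,w)$, where $(u,v,w)=(u\circ v)\circ w-u\circ(v\circ w)$. A Gel'fand-Dorfman bialgebra is a triple $(\mathcal{A},[\cdot,\cdot],\circ)$ such that $(\mathcal{A},[\cdot,\cdot])$ is a Lie algebra, $(\mathcal{A},\circ)$ is a Novikov algebra and $$[w\circ u,v]-[w\circ v,u]+[w,u]\circ v-[w,v]\circ u-w\circ[u,v]=0\quad\text{for all }u,v,w\in\mathcal{A}.$$ "$(\mathcal{A},[\cdot,\cdot])$ is a Lie algebra over the Novikov algebra $(\mathcal{A},\circ)$" means that $(\mathcal{A},[\cdot,\cdot],\circ)$ is a Gel'fand-Dorfman bialgebra. *)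

theory Defs
  imports Complex_Main
begin

definition bilinear_op :: "(complex \<Rightarrow> 'a \<Rightarrow> 'a) \<Rightarrow> ('a::ab_group_add \<Rightarrow> 'a \<Rightarrow> 'a) \<Rightarrow> bool" where
  "bilinear_op scale m \<longleftrightarrow>
     (\<forall>u. Vector_Spaces.linear scale scale (\<lambda>v. m u v)) \<and>
     (\<forall>v. Vector_Spaces.linear scale scale (\<lambda>u. m u v))"

definition associator :: "('a::ab_group_add \<Rightarrow> 'a \<Rightarrow> 'a) \<Rightarrow> 'a \<Rightarrow> 'a \<Rightarrow> 'a \<Rightarrow> 'a" where
  "associator m u v w = m (m u v) w - m u (m v w)"

definition novikov_algebra ::
    "(complex \<Rightarrow> 'a \<Rightarrow> 'a) \<Rightarrow> ('a::ab_group_add \<Rightarrow> 'a \<Rightarrow> 'a) \<Rightarrow> bool" where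
  "novikov_algebra scale m \<longleftrightarrow>
     bilinear_op scale m \<and>
     (\<forall>u v w. m (m u v) w = m (m u w) v) \<and>
     (\<forall>u v w. associator m u v w = associator m v u w)"

definition lie_algebra ::
    "(complex \<Rightarrow> 'a \<Rightarrow> 'a) \<Rightarrow> ('a::ab_group_add \<Rightarrow> 'a \<Rightarrow> 'a) \<Rightarrow> bool" where
  "lie_algebra scale br \<longleftrightarrow>
     bilinear_op scale br \<and>
     (\<forall>u. br u u = 0) \<and>
     (\<forall>u v w. br u (br v w) + br v (br w u) + br w (br u v) = 0)"

definition gelfand_dorfman_bialgebra ::
    "(complex \<Rightarrow> 'a \<Rightarrow> 'a) \<Rightarrow> ('a::ab_group_add \<Rightarrow> 'a \<Rightarrow> 'a) \<Rightarrow> ('a \<Rightarrow> 'a \<Rightarrow> 'a) \<Rightarrow> bool" where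
  "gelfand_dorfman_bialgebra scale br m \<longleftrightarrow>
     lie_algebra scale br \<and> novikov_algebra scale m \<and>
     (\<forall>u v w. br (m w u) v - br (m w v) u + m (br w u) v - m (br w v) u - m w (br u v) = 0)"

definition lie_algebra_over_novikov ::
    "(complex \<Rightarrow> 'a \<Rightarrow> 'a) \<Rightarrow> ('a::ab_group_add \<Rightarrow> 'a \<Rightarrow> 'a) \<Rightarrow> ('a \<Rightarrow> 'a \<Rightarrow> 'a) \<Rightarrow> bool" where
  "lie_algebra_over_novikov scale m br \<longleftrightarrow> gelfand_dorfman_bialgebra scale br m"

definition additive_subgroup :: "complex set \<Rightarrow> bool" where
  "additive_subgroup \<Delta> \<longleftrightarrow>
     0 \<in> \<Delta> \<and> (\<forall>\<alpha>\<in>\<Delta>. \<forall>\<beta>\<in>\<Delta>. \<alpha> + \<beta> \<in> \<Delta>) \<and> (\<forall>\<alpha>\<in>\<Delta>. - \<alpha> \<in> \<Delta>)"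

text \<open>Only the values of \<open>\<phi>\<close> on \<open>\<Delta>\<close> matter: a map \<open>\<Delta> \<rightarrow> \<complex>\<close> is represented by any of its
  extensions to \<open>\<complex>\<close>.\<close>
definition additive_hom_on :: "complex set \<Rightarrow> (complex \<Rightarrow> complex) \<Rightarrow> bool" where
  "additive_hom_on \<Delta> \<phi> \<longleftrightarrow> (\<forall>\<alpha>\<in>\<Delta>. \<forall>\<beta>\<in>\<Delta>. \<phi> (\<alpha> + \<beta>) = \<phi> \<alpha> + \<phi> \<beta>)"

text \<open>The vectors \<open>x \<alpha> i\<close> with \<open>\<alpha> \<in> \<Delta>\<close> and \<open>i \<in> \<nat>\<close> are pairwise distinct and form a basis of the whole
  space; the values \<open>x \<alpha> i\<close> with \<open>\<alpha> \<notin> \<Delta>\<close> are irrelevant.\<close>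
definition indexed_basis ::
    "(complex \<Rightarrow> 'a \<Rightarrow> 'a) \<Rightarrow> complex set \<Rightarrow> (complex \<Rightarrow> nat \<Rightarrow> 'a::ab_group_add) \<Rightarrow> bool" where
  "indexed_basis scale \<Delta> x \<longleftrightarrow>
     vector_space scale \<and>
     inj_on (\<lambda>(\<alpha>, i). x \<alpha> i) (\<Delta> \<times> UNIV) \<and>
     \<not> module.dependent scale ((\<lambda>(\<alpha>, i). x \<alpha> i) ` (\<Delta> \<times> UNIV)) \<and>
     module.span scale ((\<lambda>(\<alpha>, i). x \<alpha> i) ` (\<Delta> \<times> UNIV)) = UNIV"

text \<open>\<open>lowered x \<alpha> n\<close> stands for \<open>x\<close> with indices \<open>\<alpha>, n - 1\<close>, under the convention that \<open>x\<close> with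
  second index \<open>-1\<close> is \<open>0\<close>.\<close>
definition lowered :: "(complex \<Rightarrow> nat \<Rightarrow> 'a::zero) \<Rightarrow> complex \<Rightarrow> nat \<Rightarrow> 'a" where
  "lowered x \<alpha> n = (if n = 0 then 0 else x \<alpha> (n - 1))"

end

theory Submission
  imports Defs
begin

text \<open>Write \<open>1 = x 0 0\<close> and \<open>D u = 1 \<circ> u\<close>. On every Novikov algebra, a derivation \<open>d\<close> yields a
  Gel'fand-Dorfman bracket \<open>[u, v] = c (dv \<circ> u - du \<circ> v)\<close>; the bracket of the theorem is this one with
  \<open>c = 1 / b\<close> and \<open>d x\<^sub>\<alpha>\<^sub>,\<^sub>i = \<phi>(\<alpha>) x\<^sub>\<alpha>\<^sub>,\<^sub>i + \<lambda> i x\<^sub>\<alpha>\<^sub>,\<^sub>i\<^sub>-\<^sub>1\<close>.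

  Conversely, let \<open>[\<cdot>, \<cdot>]\<close> be any Gel'fand-Dorfman bracket and put \<open>d u = [1, u]\<close>. As \<open>u \<circ> 1 = b u\<close>,
  the compatibility condition with one argument equal to \<open>1\<close> says that \<open>d\<close> is a derivation commuting
  with \<open>D\<close>, and that \<open>C(u, v) = [u, v] - (1 / b) (dv \<circ> u - du \<circ> v)\<close> satisfies
  \<open>D C(u, v) = C(D u, v) + C(u, D v)\<close>. The eigenvalues of \<open>D\<close> are the numbers \<open>\<alpha> + b\<close> with
  \<open>\<alpha> \<in> \<Delta>\<close>, with one-dimensional eigenspaces, and \<open>b \<notin> \<Delta>\<close> gives \<open>C = 0\<close>. Finally \<open>d\<close> preserves the
  eigenspaces of \<open>D\<close> and maps \<open>x 0 1\<close> into the eigenspace of \<open>1\<close>, which determines it. The Jacobi identity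
  is a consequence.\<close>

section \<open>Bilinear products\<close>

lemma vector_space_linear_iff:
  assumes "vector_space scale"
  shows "Vector_Spaces.linear scale scale f \<longleftrightarrow>
    (\<forall>u v. f (u + v) = f u + f v) \<and> (\<forall>c u. f (scale c u) = scale c (f u))"
  using assms by (simp add: Vector_Spaces.linear_iff)

locale bilinear_product = vector_space scale
  for scale :: "complex \<Rightarrow> 'a::ab_group_add \<Rightarrow> 'a" +
  fixes m :: "'a \<Rightarrow> 'a \<Rightarrow> 'a"
  assumes bilinear: "bilinear_op scale m"
begin

lemma linear_right: "Vector_Spaces.linear scale scale (m u)"
  and linear_left: "Vector_Spaces.linear scale scale (\<lambda>u. m u v)"
  using bilinear by (auto simp: bilinear_op_def)

lemma add_right: "m u (v + w) = m u v + m u w"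
  and add_left: "m (u + v) w = m u w + m v w"
  and scale_right: "m u (scale c v) = scale c (m u v)"
  and scale_left: "m (scale c u) v = scale c (m u v)"
  using linear_right linear_left by (simp_all add: vector_space_linear_iff[OF vector_space_axioms])

lemma diff_right: "m u (v - w) = m u v - m u w"
  and diff_left: "m (u - v) w = m u w - m v w"
  and zero_right: "m u 0 = 0"
  and zero_left: "m 0 u = 0"
  and minus_right: "m u (- v) = - m u v"
  and minus_left: "m (- u) v = - m u v"
  using add_right[of u "v - w" w] add_left[of "u - v" v w]
    scale_right[of u 0 0] scale_left[of 0 0 u] scale_right[of u "-1" v] scale_left[of "-1" u v]
  by (simp_all add: algebra_simps)

lemmas product_simps = add_right add_left scale_right scale_left diff_right diff_left
  zero_right zero_left minus_right minus_left

end

section \<open>Gel'fand-Dorfman brackets from derivations of a Novikov algebra\<close>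

locale novikov_product = bilinear_product +
  assumes novikov: "novikov_algebra scale m"
begin

lemma right_commute: "m (m u v) w = m (m u w) v"
  using novikov by (simp add: novikov_algebra_def)

lemma left_symmetric: "m (m u v) w - m u (m v w) = m (m v u) w - m v (m u w)"
  using novikov by (auto simp: novikov_algebra_def associator_def)

text \<open>After expansion by the derivation rule, the terms with \<open>d (d u)\<close> in the
  Jacobi sum and those with \<open>d w\<close> in the compatibility condition cancel by right
  commutativity. What remains is a sum of defects of left symmetry.\<close>

lemma derivation_bracket_gelfand_dorfman:
  assumes lin: "Vector_Spaces.linear scale scale d"
    and deriv: "\<And>u v. d (m u v) = m (d u) v + m u (d v)"
    and br: "\<And>u v. br u v = scale c (m (d v) u - m (d u) v)"
  shows "gelfand_dorfman_bialgebra scale br m"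
proof -
  have d_add: "d (u + v) = d u + d v" and d_scale: "d (scale k u) = scale k (d u)" for u v k
    using lin vector_space_linear_iff[OF vector_space_axioms] by auto
  have d_diff: "d (u - v) = d u - d v" for u v
    using d_add[of "u - v" v] by simp
  note d_simps = d_add d_scale d_diff
  \<comment> \<open>\<open>A\<close> names the defect of left symmetry, so that the remainders can
    be written as sums of instances of \<open>A\<close> before these are set to zero.\<close>
  define A where "A p q r = (m (m p q) r - m p (m q r)) - (m (m q p) r - m q (m p r))" for p q r
  have A_zero: "A p q r = 0" for p q r
    using left_symmetric[of p q r] by (simp add: A_def)
  have "bilinear_op scale br"
    unfolding bilinear_op_def vector_space_linear_iff[OF vector_space_axioms] br
    by (simp add: d_simps product_simps scale_right_distrib scale_right_diff_distrib mult.commute)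
  moreover have "br u (br v w) + br v (br w u) + br w (br u v) = 0" for u v w
  proof -
    define J where "J u v w = m (d (m (d w) v - m (d v) w)) u - m (d u) (m (d w) v - m (d v) w)" for u v w
    have "br u (br v w) = scale (c * c) (J u v w)" for u v w
      by (simp add: br J_def d_simps product_simps scale_right_diff_distrib)
    moreover have "J u v w + J v w u + J w u v = 0"
    proof -
      have "J u v w + J v w u + J w u v = A (d w) (d v) u + A (d u) (d w) v + A (d v) (d u) w"
        using right_commute[of "d (d w)" v u] right_commute[of "d (d u)" w v] right_commute[of "d (d v)" u w]
        unfolding J_def A_def d_simps deriv product_simps by (simp add: algebra_simps)
      then show ?thesis by (simp add: A_zero)
    qed
    ultimately show ?thesis
      by (metis scale_right_distrib scale_zero_right)
  qed
  moreover have "br (m w u) v - br (m w v) u + m (br w u) v - m (br w v) u - m w (br u v) = 0" for u v w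
  proof -
    define G where "G = (m (d v) (m w u) - m (d (m w u)) v) - (m (d u) (m w v) - m (d (m w v)) u)
        + m (m (d u) w - m (d w) u) v - m (m (d v) w - m (d w) v) u - m w (m (d v) u - m (d u) v)"
    have "G = A w (d v) u + A (d u) w v"
      using right_commute[of "d w" u v]
      unfolding G_def A_def deriv product_simps by (simp add: algebra_simps)
    then have "G = 0" by (simp add: A_zero)
    moreover have "br (m w u) v - br (m w v) u + m (br w u) v - m (br w v) u - m w (br u v) = scale c G"
      by (simp add: G_def br product_simps scale_right_diff_distrib scale_right_distrib)
    ultimately show ?thesis by simp
  qed
  moreover have "br u u = 0" for u by (simp add: br)
  ultimately show ?thesis
    using novikov by (simp add: gelfand_dorfman_bialgebra_def lie_algebra_def)
qed

end

section \<open>The algebra, its basis and its coordinates\<close>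

locale truncated_exponential_novikov = bilinear_product scale nov
  for scale :: "complex \<Rightarrow> 'a::ab_group_add \<Rightarrow> 'a" and nov :: "'a \<Rightarrow> 'a \<Rightarrow> 'a" +
  fixes \<Delta> :: "complex set" and b :: complex and x :: "complex \<Rightarrow> nat \<Rightarrow> 'a"
  assumes subgroup: "additive_subgroup \<Delta>"
    and b_notin: "b \<notin> \<Delta>"
    and basis: "indexed_basis scale \<Delta> x"
    and nov_basis: "\<And>\<alpha> \<beta> i j. \<alpha> \<in> \<Delta> \<Longrightarrow> \<beta> \<in> \<Delta> \<Longrightarrow> nov (x \<alpha> i) (x \<beta> j) =
           scale (\<beta> + b) (x (\<alpha> + \<beta>) (i + j)) + scale (of_nat j) (lowered x (\<alpha> + \<beta>) (i + j))"
begin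

lemma zero_in: "0 \<in> \<Delta>"
  and add_in: "\<alpha> \<in> \<Delta> \<Longrightarrow> \<beta> \<in> \<Delta> \<Longrightarrow> \<alpha> + \<beta> \<in> \<Delta>"
  and uminus_in: "\<alpha> \<in> \<Delta> \<Longrightarrow> - \<alpha> \<in> \<Delta>"
  using subgroup by (auto simp: additive_subgroup_def)

lemma add_b_notin:
  assumes "\<alpha> \<in> \<Delta>"
  shows "\<alpha> + b \<notin> \<Delta>"
  using add_in[of "\<alpha> + b" "- \<alpha>"] uminus_in[OF assms] b_notin by auto

lemma add_b_nonzero: "\<alpha> \<in> \<Delta> \<Longrightarrow> \<alpha> + b \<noteq> 0"
  using add_b_notin zero_in by metis

lemma b_nonzero: "b \<noteq> 0"
  using b_notin zero_in by metis

abbreviation basis_set :: "'a set" where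
  "basis_set \<equiv> (\<lambda>(\<alpha>, i). x \<alpha> i) ` (\<Delta> \<times> UNIV)"

lemma independent_basis: "independent basis_set"
  and span_basis: "span basis_set = UNIV"
  and basis_inj: "inj_on (\<lambda>(\<alpha>, i). x \<alpha> i) (\<Delta> \<times> UNIV)"
  using basis by (simp_all add: indexed_basis_def)

lemma basis_eq_iff: "\<alpha> \<in> \<Delta> \<Longrightarrow> \<beta> \<in> \<Delta> \<Longrightarrow> x \<alpha> i = x \<beta> j \<longleftrightarrow> \<alpha> = \<beta> \<and> i = j"
  using inj_on_eq_iff[OF basis_inj, of "(\<alpha>, i)" "(\<beta>, j)"] by simp

lemma basis_induct [case_names zero step]:
  assumes "P 0"
    and "\<And>c \<alpha> i u. \<alpha> \<in> \<Delta> \<Longrightarrow> P u \<Longrightarrow> P (scale c (x \<alpha> i) + u)"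
  shows "P u"
proof -
  have "u \<in> span basis_set" by (simp add: span_basis)
  then show ?thesis by (induction rule: span_induct_alt) (use assms in auto)
qed

text \<open>Nested, once per argument, this reduces multilinear identities to basis vectors.\<close>

lemma linear_eq_zeroI:
  assumes add: "\<And>u v. f (u + v) = f u + f v"
    and scale: "\<And>c u. f (scale c u) = scale c (f u)"
    and zero: "\<And>\<alpha> i. \<alpha> \<in> \<Delta> \<Longrightarrow> f (x \<alpha> i) = 0"
  shows "f u = 0"
  using scale[of 0 0] by (induction u rule: basis_induct) (simp_all add: add scale zero)

definition coeff :: "'a \<Rightarrow> complex \<Rightarrow> nat \<Rightarrow> complex" where
  "coeff u \<alpha> i = representation basis_set u (x \<alpha> i)"

lemma coeff_add: "coeff (u + v) \<alpha> i = coeff u \<alpha> i + coeff v \<alpha> i"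
  and coeff_diff: "coeff (u - v) \<alpha> i = coeff u \<alpha> i - coeff v \<alpha> i"
  and coeff_scale: "coeff (scale c u) \<alpha> i = c * coeff u \<alpha> i"
  and coeff_zero: "coeff 0 \<alpha> i = 0"
  by (simp_all add: coeff_def independent_basis span_basis representation_add representation_diff
      representation_scale representation_zero)

lemma coeff_basis:
  assumes "\<alpha> \<in> \<Delta>" "\<beta> \<in> \<Delta>"
  shows "coeff (x \<beta> j) \<alpha> i = (if \<alpha> = \<beta> \<and> i = j then 1 else 0)"
proof -
  have "x \<beta> j \<in> basis_set" using assms by force
  then show ?thesis
    by (simp add: coeff_def representation_basis[OF independent_basis] basis_eq_iff assms)
qed

lemma coeff_lowered:
  assumes "\<alpha> \<in> \<Delta>" "\<beta> \<in> \<Delta>"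
  shows "coeff (lowered x \<beta> j) \<alpha> i = (if \<alpha> = \<beta> \<and> Suc i = j then 1 else 0)"
  by (cases j) (simp_all add: lowered_def coeff_zero coeff_basis assms)

lemma eq_zero_if_coeff_zero:
  assumes "\<And>\<alpha> i. \<alpha> \<in> \<Delta> \<Longrightarrow> coeff u \<alpha> i = 0"
  shows "u = 0"
proof -
  have "representation basis_set u v = 0" for v
    using assms representation_ne_zero[of basis_set u v] by (fastforce simp: coeff_def)
  then show ?thesis
    using sum_nonzero_representation_eq[OF independent_basis, of u] span_basis by simp
qed

lemma finite_coeff:
  assumes "\<alpha> \<in> \<Delta>"
  shows "finite {i. coeff u \<alpha> i \<noteq> 0}"
proof -
  have "finite (x \<alpha> -` {v. representation basis_set u v \<noteq> 0})"
    by (rule finite_vimageI[OF finite_representation]) (use basis_eq_iff assms in \<open>auto simp: inj_def\<close>)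
  then show ?thesis by (simp add: coeff_def vimage_def)
qed

section \<open>Eigenvectors of \<open>nov one\<close>\<close>

abbreviation one :: 'a where
  "one \<equiv> x 0 0"

lemma one_nov: "\<alpha> \<in> \<Delta> \<Longrightarrow> nov one (x \<alpha> i) = scale (\<alpha> + b) (x \<alpha> i) + scale (of_nat i) (lowered x \<alpha> i)"
  using nov_basis[OF zero_in, of \<alpha> 0 i] by simp

lemma nov_one: "nov u one = scale b u"
proof -
  have "nov u one - scale b u = 0"
    by (rule linear_eq_zeroI[where f = "\<lambda>u. nov u one - scale b u"])
      (use nov_basis[OF _ zero_in] in \<open>simp_all add: product_simps scale_right_distrib
          scale_right_diff_distrib mult.commute\<close>)
  then show ?thesis by simp
qed

lemma coeff_one_nov:
  assumes "\<alpha> \<in> \<Delta>"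
  shows "coeff (nov one u) \<alpha> i = (\<alpha> + b) * coeff u \<alpha> i + of_nat (Suc i) * coeff u \<alpha> (Suc i)"
proof (induction u rule: basis_induct)
  case zero
  then show ?case by (simp add: product_simps coeff_zero)
next
  case (step c \<beta> j u)
  then show ?case
    using assms by (simp add: product_simps coeff_add coeff_scale one_nov coeff_basis coeff_lowered algebra_simps)
      (auto simp: algebra_simps)
qed

text \<open>For fixed \<open>\<alpha>\<close> the eigenvalue equation is a recursion on coordinates.
  If \<open>c \<noteq> \<alpha> + b\<close>, a nonzero coordinate forces all later ones to be
  nonzero, against finite support. If \<open>c = \<alpha> + b\<close>, the recursion kills every
  coordinate of positive index.\<close>

lemma eigenvector_coeff:
  assumes eig: "nov one u = scale c u" and \<alpha>: "\<alpha> \<in> \<Delta>" and nz: "coeff u \<alpha> i \<noteq> 0"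
  shows "c = \<alpha> + b \<and> i = 0"
proof -
  have rec: "(c - (\<alpha> + b)) * coeff u \<alpha> k = of_nat (Suc k) * coeff u \<alpha> (Suc k)" for k
    using coeff_one_nov[OF \<alpha>, of u k] by (simp add: eig coeff_scale algebra_simps)
  have c: "c = \<alpha> + b"
  proof (rule ccontr)
    assume "c \<noteq> \<alpha> + b"
    then have step: "coeff u \<alpha> k \<noteq> 0 \<Longrightarrow> coeff u \<alpha> (Suc k) \<noteq> 0" for k
      using rec[of k] by auto
    have "coeff u \<alpha> (i + k) \<noteq> 0" for k
      by (induction k) (simp_all add: nz step)
    then have "range (\<lambda>k. i + k) \<subseteq> {k. coeff u \<alpha> k \<noteq> 0}" by auto
    then have "finite (range (\<lambda>k. i + k))"
      using finite_coeff[OF \<alpha>] finite_subset by blast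
    then show False by (simp add: finite_image_iff)
  qed
  moreover have "i = 0"
    using rec[of "i - 1"] nz c by (cases i) (auto simp del: of_nat_Suc)
  ultimately show ?thesis by simp
qed

lemma eigenvector_zero:
  assumes "nov one u = scale c u" "c - b \<notin> \<Delta>"
  shows "u = 0"
proof (rule eq_zero_if_coeff_zero)
  fix \<alpha> i assume "\<alpha> \<in> \<Delta>"
  then show "coeff u \<alpha> i = 0"
    using eigenvector_coeff[OF assms(1), of \<alpha> i] assms(2) by (metis add_diff_cancel_right')
qed

lemma eigenvector_basis:
  assumes "nov one u = scale (\<alpha> + b) u" "\<alpha> \<in> \<Delta>"
  shows "u = scale (coeff u \<alpha> 0) (x \<alpha> 0)"
proof -
  have "u - scale (coeff u \<alpha> 0) (x \<alpha> 0) = 0"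
  proof (rule eq_zero_if_coeff_zero)
    fix \<beta> i assume "\<beta> \<in> \<Delta>"
    then show "coeff (u - scale (coeff u \<alpha> 0) (x \<alpha> 0)) \<beta> i = 0"
      using eigenvector_coeff[OF assms(1), of \<beta> i] assms(2)
      by (auto simp: coeff_diff coeff_scale coeff_basis)
  qed
  then show ?thesis by simp
qed

section \<open>The Novikov identities\<close>

definition lowered_twice :: "complex \<Rightarrow> nat \<Rightarrow> 'a" where
  "lowered_twice \<alpha> n = (if n < 2 then 0 else x \<alpha> (n - 2))"

text \<open>Without the factor \<open>of_nat i\<close> the identity fails for \<open>h = i = 0 < j\<close>: then \<open>lowered x \<alpha> 0 = 0\<close>,
  whereas \<open>lowered x (\<alpha> + \<beta>) j\<close> is a basis vector.\<close>
lemma nov_lowered_left: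
  assumes "\<alpha> \<in> \<Delta>" "\<beta> \<in> \<Delta>"
  shows "scale (of_nat i) (nov (lowered x \<alpha> (h + i)) (x \<beta> j)) =
    scale (of_nat i * (\<beta> + b)) (lowered x (\<alpha> + \<beta>) (h + i + j))
    + scale (of_nat i * of_nat j) (lowered_twice (\<alpha> + \<beta>) (h + i + j))"
proof (cases i)
  case (Suc k)
  have "scale (of_nat j) (lowered x (\<alpha> + \<beta>) (h + k + j)) = scale (of_nat j) (lowered_twice (\<alpha> + \<beta>) (Suc (h + k + j)))"
    by (cases j) (simp_all add: lowered_def lowered_twice_def)
  then show ?thesis using Suc assms
    by (simp add: lowered_def[of _ _ "Suc _"] nov_basis scale_right_distrib flip: scale_scale)
qed simp

text \<open>For \<open>j > 0\<close> the lowered vector is \<open>x \<beta> (h + j - 1)\<close>,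
  whose own second index supplies the factor \<open>of_nat h + of_nat j - 1\<close>. In triple
  products, \<open>h\<close> is the second index of the middle vector.\<close>

lemma nov_lowered_right:
  assumes "\<alpha> \<in> \<Delta>" "\<beta> \<in> \<Delta>"
  shows "scale (of_nat j) (nov (x \<alpha> i) (lowered x \<beta> (h + j))) =
    scale (of_nat j * (\<beta> + b)) (lowered x (\<alpha> + \<beta>) (i + h + j))
    + scale (of_nat j * (of_nat h + of_nat j - 1)) (lowered_twice (\<alpha> + \<beta>) (i + h + j))"
proof (cases j)
  case (Suc k)
  have "scale (of_nat (h + k)) (lowered x (\<alpha> + \<beta>) (i + h + k)) = scale (of_nat (h + k)) (lowered_twice (\<alpha> + \<beta>) (Suc (i + h + k)))"
    by (cases "h + k") (auto simp: lowered_def lowered_twice_def)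
  then show ?thesis using Suc assms
    by (simp add: lowered_def[of _ _ "Suc _"] nov_basis scale_right_distrib add.assoc flip: scale_scale)
qed simp

lemma nov_novikov: "novikov_algebra scale nov"
proof -
  \<comment> \<open>All three coefficients are unchanged when \<open>(\<beta>, j)\<close> and
    \<open>(\<gamma>, k)\<close> are exchanged, which is right commutativity.\<close>
  have left: "nov (nov (x \<alpha> i) (x \<beta> j)) (x \<gamma> k) =
      scale ((\<beta> + b) * (\<gamma> + b)) (x (\<alpha> + \<beta> + \<gamma>) (i + j + k))
      + scale (of_nat k * (\<beta> + b) + of_nat j * (\<gamma> + b)) (lowered x (\<alpha> + \<beta> + \<gamma>) (i + j + k))
      + scale (of_nat j * of_nat k) (lowered_twice (\<alpha> + \<beta> + \<gamma>) (i + j + k))"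
    if "\<alpha> \<in> \<Delta>" "\<beta> \<in> \<Delta>" "\<gamma> \<in> \<Delta>" for \<alpha> \<beta> \<gamma> i j k
    using that
    by (simp add: nov_basis product_simps add_in nov_lowered_left scale_right_distrib
        scale_left_distrib[of "of_nat k * (\<beta> + b)"] mult.commute)
  have right: "nov (x \<alpha> i) (nov (x \<beta> j) (x \<gamma> k)) =
      scale ((\<gamma> + b) * (\<beta> + \<gamma> + b)) (x (\<alpha> + \<beta> + \<gamma>) (i + j + k))
      + scale ((\<gamma> + b) * (of_nat j + of_nat k) + of_nat k * (\<beta> + \<gamma> + b)) (lowered x (\<alpha> + \<beta> + \<gamma>) (i + j + k))
      + scale (of_nat k * (of_nat j + of_nat k - 1)) (lowered_twice (\<alpha> + \<beta> + \<gamma>) (i + j + k))"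
    if "\<alpha> \<in> \<Delta>" "\<beta> \<in> \<Delta>" "\<gamma> \<in> \<Delta>" for \<alpha> \<beta> \<gamma> i j k
    using that
    by (simp add: nov_basis product_simps add_in nov_lowered_right scale_right_distrib
        scale_left_distrib[of "(\<gamma> + b) * (of_nat j + of_nat k)"] add.assoc)
  \<comment> \<open>The coefficients involve only \<open>\<gamma>\<close> and \<open>k\<close>, and
    the vectors only sums of indices, so exchanging the first two arguments changes nothing.\<close>
  have assoc: "associator nov (x \<alpha> i) (x \<beta> j) (x \<gamma> k) =
      scale (- ((\<gamma> + b) * \<gamma>)) (x (\<alpha> + \<beta> + \<gamma>) (i + j + k))
      + scale (- (of_nat k * (2 * \<gamma> + b))) (lowered x (\<alpha> + \<beta> + \<gamma>) (i + j + k))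
      + scale (- (of_nat k * (of_nat k - 1))) (lowered_twice (\<alpha> + \<beta> + \<gamma>) (i + j + k))"
    if "\<alpha> \<in> \<Delta>" "\<beta> \<in> \<Delta>" "\<gamma> \<in> \<Delta>" for \<alpha> \<beta> \<gamma> i j k
  proof -
    have collect: "scale p X + scale q Y + scale r Z - (scale p' X + scale q' Y + scale r' Z) =
        scale (p - p') X + scale (q - q') Y + scale (r - r') Z" for p q r p' q' r' X Y Z
      by (simp add: scale_left_diff_distrib)
    have coeffs: "(\<beta> + b) * (\<gamma> + b) - (\<gamma> + b) * (\<beta> + \<gamma> + b) = - ((\<gamma> + b) * \<gamma>)"
      "of_nat k * (\<beta> + b) + of_nat j * (\<gamma> + b) - ((\<gamma> + b) * (of_nat j + of_nat k) + of_nat k * (\<beta> + \<gamma> + b)) =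
        - (of_nat k * (2 * \<gamma> + b))"
      "of_nat j * of_nat k - of_nat k * (of_nat j + of_nat k - 1) = - (of_nat k * (of_nat k - 1 :: complex))"
      by (simp_all add: algebra_simps)
    show ?thesis
      unfolding associator_def left[OF that] right[OF that] collect coeffs ..
  qed
  have rc: "nov (nov u v) w - nov (nov u w) v = 0" for u v w
  proof (rule linear_eq_zeroI[where u = u], goal_cases)
    case (3 \<alpha> i) show ?case
    proof (rule linear_eq_zeroI[where u = v], goal_cases)
      case (3 \<beta> j) show ?case
      proof (rule linear_eq_zeroI[where u = w], goal_cases)
        case (3 \<gamma> k)
        then show ?case using \<open>\<alpha> \<in> \<Delta>\<close> \<open>\<beta> \<in> \<Delta>\<close> by (simp add: left ac_simps)
      qed (simp_all add: product_simps scale_right_diff_distrib)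
    qed (simp_all add: product_simps scale_right_diff_distrib)
  qed (simp_all add: product_simps scale_right_diff_distrib)
  have ls: "associator nov u v w - associator nov v u w = 0" for u v w
  proof (rule linear_eq_zeroI[where u = u], goal_cases)
    case (3 \<alpha> i) show ?case
    proof (rule linear_eq_zeroI[where u = v], goal_cases)
      case (3 \<beta> j) show ?case
      proof (rule linear_eq_zeroI[where u = w], goal_cases)
        case (3 \<gamma> k)
        then show ?case using \<open>\<alpha> \<in> \<Delta>\<close> \<open>\<beta> \<in> \<Delta>\<close> by (simp add: assoc ac_simps)
      qed (simp_all add: associator_def product_simps scale_right_diff_distrib)
    qed (simp_all add: associator_def product_simps scale_right_diff_distrib)
  qed (simp_all add: associator_def product_simps scale_right_diff_distrib)
  show ?thesis
    using rc ls bilinear by (simp add: novikov_algebra_def)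
qed

sublocale novikov_product scale nov
  by unfold_locales (rule nov_novikov)

section \<open>The derivation given by \<open>\<phi>\<close> and \<open>lam\<close>, and its
  bracket\<close>

context
  fixes d :: "'a \<Rightarrow> 'a" and \<phi> :: "complex \<Rightarrow> complex" and lam :: complex
  assumes d_linear: "Vector_Spaces.linear scale scale d"
    and \<phi>: "additive_hom_on \<Delta> \<phi>"
    and d_basis: "\<And>\<alpha> i. \<alpha> \<in> \<Delta> \<Longrightarrow> d (x \<alpha> i) = scale (\<phi> \<alpha>) (x \<alpha> i) + scale (lam * of_nat i) (lowered x \<alpha> i)"
begin

lemma d_add: "d (u + v) = d u + d v" and d_scale: "d (scale c u) = scale c (d u)"
  using d_linear vector_space_linear_iff[OF vector_space_axioms] by auto

lemma d_lowered:
  assumes "\<alpha> \<in> \<Delta>"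
  shows "scale (of_nat j) (d (lowered x \<alpha> (i + j))) =
    scale (of_nat j * \<phi> \<alpha>) (lowered x \<alpha> (i + j))
    + scale (of_nat j * (lam * (of_nat i + of_nat j - 1))) (lowered_twice \<alpha> (i + j))"
proof (cases j)
  case (Suc k)
  have "scale (of_nat (i + k)) (lowered x \<alpha> (i + k)) = scale (of_nat (i + k)) (lowered_twice \<alpha> (Suc (i + k)))"
    by (cases "i + k") (auto simp: lowered_def lowered_twice_def)
  then show ?thesis using Suc assms
    by (simp add: lowered_def[of _ _ "Suc _"] d_basis scale_right_distrib flip: scale_scale)
qed simp

text \<open>Conceptually, \<open>nov u v\<close> is the product of \<open>u\<close> with
  \<open>nov one v\<close> in the commutative algebra where \<open>x \<alpha> i\<close> times
  \<open>x \<beta> j\<close> is \<open>x (\<alpha> + \<beta>) (i + j)\<close>. There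
  \<open>d\<close> is a derivation, by additivity of \<open>\<phi>\<close>, and it commutes with
  \<open>nov one\<close>. The proof checks the rule on basis vectors.\<close>

lemma d_nov: "d (nov u v) = nov (d u) v + nov u (d v)"
proof -
  have "d (nov u v) - nov (d u) v - nov u (d v) = 0"
  proof (rule linear_eq_zeroI[where u = u], goal_cases)
    case (3 \<alpha> i) show ?case
    proof (rule linear_eq_zeroI[where u = v], goal_cases)
      case (3 \<beta> j)
      have "\<phi> (\<alpha> + \<beta>) = \<phi> \<alpha> + \<phi> \<beta>" using 3 \<open>\<alpha> \<in> \<Delta>\<close> \<phi> by (simp add: additive_hom_on_def)
      then show ?case
        using 3 \<open>\<alpha> \<in> \<Delta>\<close> d_lowered[of "\<alpha> + \<beta>" j i] nov_lowered_left[of \<alpha> \<beta> i 0 j] nov_lowered_right[of \<alpha> \<beta> j i 0]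
        by (simp add: nov_basis d_basis d_add d_scale product_simps add_in
           flip: scale_scale) (simp add: algebra_simps)
    qed (simp_all add: product_simps scale_right_diff_distrib d_add d_scale)
  qed (simp_all add: product_simps scale_right_diff_distrib d_add d_scale)
  then show ?thesis by (simp add: algebra_simps)
qed

text \<open>This identifies the formula of the theorem as a derivation bracket and serves both
  directions.\<close>

lemma derivation_bracket_basis:
  assumes "\<alpha> \<in> \<Delta>" "\<beta> \<in> \<Delta>"
  shows "scale (1 / b) (nov (d (x \<beta> j)) (x \<alpha> i) - nov (d (x \<alpha> i)) (x \<beta> j)) =
    scale (1 / b * ((\<alpha> + b) * \<phi> \<beta> - (\<beta> + b) * \<phi> \<alpha>)) (x (\<alpha> + \<beta>) (i + j))
    + scale (1 / b * (of_nat i * (\<phi> \<beta> - lam * (\<beta> + b)) + of_nat j * (lam * (\<alpha> + b) - \<phi> \<alpha>)))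
        (lowered x (\<alpha> + \<beta>) (i + j))"
proof -
  have "nov (d (x \<beta> j)) (x \<alpha> i) - nov (d (x \<alpha> i)) (x \<beta> j) =
    scale ((\<alpha> + b) * \<phi> \<beta> - (\<beta> + b) * \<phi> \<alpha>) (x (\<alpha> + \<beta>) (i + j))
    + scale (of_nat i * (\<phi> \<beta> - lam * (\<beta> + b)) + of_nat j * (lam * (\<alpha> + b) - \<phi> \<alpha>))
        (lowered x (\<alpha> + \<beta>) (i + j))"
    using assms nov_lowered_left[of \<beta> \<alpha> j 0 i] nov_lowered_left[of \<alpha> \<beta> i 0 j]
    by (simp add: nov_basis d_basis product_simps flip: scale_scale) (simp add: algebra_simps)
  then show ?thesis by (simp add: scale_right_distrib)
qed

end

section \<open>The formula gives a Gel'fand-Dorfman bialgebra\<close>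

lemma gelfand_dorfman_if_basis:
  assumes br: "bilinear_op scale br" and \<phi>: "additive_hom_on \<Delta> \<phi>"
    and br_basis: "\<And>\<alpha> \<beta> i j. \<alpha> \<in> \<Delta> \<Longrightarrow> \<beta> \<in> \<Delta> \<Longrightarrow> br (x \<alpha> i) (x \<beta> j) =
      scale (1 / b * ((\<alpha> + b) * \<phi> \<beta> - (\<beta> + b) * \<phi> \<alpha>)) (x (\<alpha> + \<beta>) (i + j))
      + scale (1 / b * (of_nat i * (\<phi> \<beta> - lam * (\<beta> + b)) + of_nat j * (lam * (\<alpha> + b) - \<phi> \<alpha>)))
          (lowered x (\<alpha> + \<beta>) (i + j))"
  shows "gelfand_dorfman_bialgebra scale br nov"
proof -
  interpret br: bilinear_product scale br by unfold_locales (rule br)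
  have \<phi>0: "\<phi> 0 = 0" using \<phi> zero_in by (force simp: additive_hom_on_def)
  \<comment> \<open>The derivation is recovered from the bracket itself: for first argument
    \<open>one\<close>, \<open>\<phi> 0 = 0\<close> and the factor \<open>b\<close> cancels.\<close>
  have d_basis: "br one (x \<alpha> i) = scale (\<phi> \<alpha>) (x \<alpha> i) + scale (lam * of_nat i) (lowered x \<alpha> i)"
    if "\<alpha> \<in> \<Delta>" for \<alpha> i
    using br_basis[OF zero_in that, of 0 i] b_nonzero by (simp add: \<phi>0 mult.commute)
  note d = br.linear_right \<phi> d_basis
  have "br u v - scale (1 / b) (nov (br one v) u - nov (br one u) v) = 0" for u v
  proof (rule linear_eq_zeroI[where u = u], goal_cases)
    case (3 \<alpha> i) show ?case
    proof (rule linear_eq_zeroI[where u = v], goal_cases)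
      case (3 \<beta> j)
      then show ?case
        using \<open>\<alpha> \<in> \<Delta>\<close> derivation_bracket_basis[OF d, of \<alpha> \<beta> j i] by (simp add: br_basis)
    qed (simp_all add: product_simps br.product_simps scale_right_distrib scale_right_diff_distrib mult.commute)
  qed (simp_all add: product_simps br.product_simps scale_right_distrib scale_right_diff_distrib mult.commute)
  then have br_eq: "br u v = scale (1 / b) (nov (br one v) u - nov (br one u) v)" for u v
    by (simp only: eq_iff_diff_eq_0[of "br u v"])
  show ?thesis
    by (rule derivation_bracket_gelfand_dorfman[OF br.linear_right d_nov[OF d] br_eq])
qed

section \<open>Gel'fand-Dorfman brackets are derivation brackets\<close>

context
  fixes br :: "'a \<Rightarrow> 'a \<Rightarrow> 'a"
  assumes gd: "gelfand_dorfman_bialgebra scale br nov"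
begin

interpretation br: bilinear_product scale br
  by unfold_locales (use gd in \<open>simp add: gelfand_dorfman_bialgebra_def lie_algebra_def\<close>)

lemma br_self: "br u u = 0"
  and gd_identity: "br (nov w u) v - br (nov w v) u + nov (br w u) v - nov (br w v) u - nov w (br u v) = 0"
  using gd by (simp_all add: gelfand_dorfman_bialgebra_def lie_algebra_def)

lemma br_antisym: "br u v = - br v u"
  using br_self[of "u + v"] unfolding br.add_left br.add_right
  by (simp add: br_self eq_neg_iff_add_eq_0 add.commute)

text \<open>In the compatibility condition with \<open>v = one\<close>, the two terms
  \<open>scale b (br w u)\<close> arising from \<open>nov_one\<close> cancel; antisymmetry turns the
  rest into the Leibniz rule.\<close>

lemma br_one_nov: "br one (nov w u) = nov (br one w) u + nov w (br one u)"
  using gd_identity[of w u one] br_antisym[of "nov w u" one] br_antisym[of u one] br_antisym[of w one]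
  by (simp add: nov_one product_simps br.product_simps algebra_simps)

text \<open>For each of the two brackets, \<open>nov one\<close> obeys the Leibniz rule up to the
  same term \<open>nov (br one u) v - nov (br one v) u\<close>, which drops out of the
  difference.\<close>

lemma gelfand_dorfman_bracket_defect:
  defines "C \<equiv> \<lambda>u v. br u v - scale (1 / b) (nov (br one v) u - nov (br one u) v)"
  shows "nov one (C u v) = C (nov one u) v + C u (nov one v)"
proof -
  have comm: "br one (nov one u) = nov one (br one u)" for u
    using br_one_nov[of one u] by (simp add: br_self product_simps)
  \<comment> \<open>Left symmetry makes \<open>nov one\<close> a derivation of \<open>nov\<close> up
    to \<open>- scale b (nov a c)\<close>. The factor \<open>1 / b\<close> of the derivation bracket
    turns this into the common term.\<close>
  have ls: "nov one (nov a c) = nov (nov one a) c - scale b (nov a c) + nov a (nov one c)" for a c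
    using left_symmetric[of one a c] by (simp add: nov_one product_simps algebra_simps)
  have "nov one (br u v) = br (nov one u) v + br u (nov one v) + nov (br one u) v - nov (br one v) u"
    using gd_identity[of one u v] br_antisym[of "nov one v" u] by (simp add: algebra_simps)
  moreover have "nov one (nov (br one v) u - nov (br one u) v) =
      (nov (br one v) (nov one u) - nov (br one (nov one u)) v)
      + (nov (br one (nov one v)) u - nov (br one u) (nov one v))
      - scale b (nov (br one v) u - nov (br one u) v)"
    by (simp add: product_simps ls comm scale_right_diff_distrib)
  moreover have "scale (1 / b) (p + q - scale b r) = scale (1 / b) p + scale (1 / b) q - r" for p q r
    using b_nonzero by (simp add: scale_right_distrib scale_right_diff_distrib)
  ultimately show ?thesis
    unfolding C_def diff_right[of one "br u v"] scale_right[of one "1 / b"] by simp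
qed

text \<open>By the previous lemma, the difference \<open>C\<close> of the two brackets maps a pair of (generalised)
  eigenvectors of \<open>nov one\<close> with eigenvalues \<open>\<alpha> + b\<close> and \<open>\<beta> + b\<close> to one with eigenvalue
  \<open>\<alpha> + \<beta> + 2 * b\<close>. All eigenvalues lie in \<open>\<Delta> + b\<close>, so \<open>b \<notin> \<Delta>\<close> forces \<open>C\<close> to vanish.\<close>
lemma bracket_eq_derivation_bracket: "br u v = scale (1 / b) (nov (br one v) u - nov (br one u) v)"
proof -
  define C where "C u v = br u v - scale (1 / b) (nov (br one v) u - nov (br one u) v)" for u v
  have C_bilinear: "C (u + u') v = C u v + C u' v" "C (scale c u) v = scale c (C u v)"
    "C u (v + v') = C u v + C u v'" "C u (scale c v) = scale c (C u v)" for u u' v v' c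
    by (simp_all add: C_def product_simps br.product_simps scale_right_distrib
        scale_right_diff_distrib mult.commute)
  have defect: "nov one (C u v) = C (nov one u) v + C u (nov one v)" for u v
    unfolding C_def by (rule gelfand_dorfman_bracket_defect)
  have C_basis: "C (x \<alpha> i) (x \<beta> j) = 0" if \<alpha>: "\<alpha> \<in> \<Delta>" and \<beta>: "\<beta> \<in> \<Delta>" for \<alpha> \<beta> i j
  proof (induction "i + j" arbitrary: i j rule: less_induct)
    case less
    \<comment> \<open>At index 0 the scalar vanishes; otherwise lowering decreases
      \<open>i + j\<close> and the induction hypothesis applies. Only the eigenvalue terms of the
      defect identity survive.\<close>
    have "scale (of_nat i) (C (lowered x \<alpha> i) (x \<beta> j)) = 0"
      using less by (cases i) (simp_all add: lowered_def)
    moreover have "scale (of_nat j) (C (x \<alpha> i) (lowered x \<beta> j)) = 0"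
      using less by (cases j) (simp_all add: lowered_def)
    ultimately have "nov one (C (x \<alpha> i) (x \<beta> j)) = scale ((\<alpha> + b) + (\<beta> + b)) (C (x \<alpha> i) (x \<beta> j))"
      by (simp only: defect one_nov[OF \<alpha>] one_nov[OF \<beta>] C_bilinear add_0_right
          scale_left_distrib[of "\<alpha> + b" "\<beta> + b"])
    then show ?case
      by (rule eigenvector_zero)
        (use add_b_notin[OF add_in[OF \<alpha> \<beta>]] in \<open>simp add: algebra_simps\<close>)
  qed
  have "C u v = 0"
  proof (rule linear_eq_zeroI[where u = u], goal_cases)
    case (3 \<alpha> i) show ?case
      by (rule linear_eq_zeroI[where u = v]) (simp_all add: C_bilinear C_basis 3)
  qed (simp_all add: C_bilinear)
  then show ?thesis by (simp add: C_def)
qed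

section \<open>Determination of the derivation\<close>

lemma br_one_basis:
  defines "\<phi> \<equiv> \<lambda>\<alpha>. coeff (br one (x \<alpha> 0)) \<alpha> 0" and "lam \<equiv> coeff (br one (x 0 1)) 0 0"
  shows "additive_hom_on \<Delta> \<phi>"
    and "\<alpha> \<in> \<Delta> \<Longrightarrow> br one (x \<alpha> i) = scale (\<phi> \<alpha>) (x \<alpha> i) + scale (lam * of_nat i) (lowered x \<alpha> i)"
proof -
  have comm: "br one (nov one u) = nov one (br one u)" for u
    using br_one_nov[of one u] by (simp add: br_self product_simps)
  have base: "br one (x \<alpha> 0) = scale (\<phi> \<alpha>) (x \<alpha> 0)" if "\<alpha> \<in> \<Delta>" for \<alpha>
    unfolding \<phi>_def
    by (rule eigenvector_basis) (use that comm[of "x \<alpha> 0"] in \<open>simp_all add: one_nov br.product_simps\<close>)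
  \<comment> \<open>Since \<open>nov one (x 0 1)\<close> is \<open>scale b (x 0 1) + one\<close> and
    \<open>br one one = 0\<close>, commuting makes \<open>br one (x 0 1)\<close> an eigenvector for
    \<open>0 + b\<close>.\<close>
  have x01: "br one (x 0 1) = scale lam one"
    unfolding lam_def
    by (rule eigenvector_basis)
      (use zero_in comm[of "x 0 1"] in \<open>simp_all add: one_nov br.product_simps lowered_def br_self\<close>)
  show "additive_hom_on \<Delta> \<phi>"
    unfolding additive_hom_on_def
  proof (intro ballI)
    fix \<alpha> \<beta> assume \<alpha>\<beta>: "\<alpha> \<in> \<Delta>" "\<beta> \<in> \<Delta>"
    \<comment> \<open>The Leibniz rule is applied to
      \<open>nov (x \<alpha> 0) (x \<beta> 0)\<close>; the factor \<open>\<beta> + b\<close> is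
      nonzero because \<open>b \<notin> \<Delta>\<close>.\<close>
    have "scale ((\<beta> + b) * \<phi> (\<alpha> + \<beta>)) (x (\<alpha> + \<beta>) 0) = scale ((\<beta> + b) * (\<phi> \<alpha> + \<phi> \<beta>)) (x (\<alpha> + \<beta>) 0)"
      using br_one_nov[of "x \<alpha> 0" "x \<beta> 0"] \<alpha>\<beta>
      by (simp add: nov_basis base add_in product_simps br.product_simps scale_left_distrib algebra_simps)
    moreover have "x (\<alpha> + \<beta>) 0 \<noteq> 0"
      using coeff_basis[OF add_in add_in, OF \<alpha>\<beta> \<alpha>\<beta>, of 0 0] coeff_zero by auto
    ultimately show "\<phi> (\<alpha> + \<beta>) = \<phi> \<alpha> + \<phi> \<beta>"
      using add_b_nonzero[OF \<alpha>\<beta>(2)] by simp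
  qed
  show "br one (x \<alpha> i) = scale (\<phi> \<alpha>) (x \<alpha> i) + scale (lam * of_nat i) (lowered x \<alpha> i)" if "\<alpha> \<in> \<Delta>"
  proof (induction i)
    case 0
    then show ?case using that by (simp add: base)
  next
    case (Suc i)
    \<comment> \<open>Right multiplication by \<open>x 0 1\<close> raises the second index, with
      \<open>b \<noteq> 0\<close> in front, so the Leibniz rule carries the formula from
      \<open>i\<close> to \<open>Suc i\<close>.\<close>
    have up: "nov (x \<alpha> i) (x 0 1) = scale b (x \<alpha> (Suc i)) + x \<alpha> i"
      using nov_basis[OF that zero_in, of i 1] by (simp add: lowered_def)
    have low: "scale (lam * of_nat i) (nov (lowered x \<alpha> i) (x 0 1)) =
        scale (b * (lam * of_nat i)) (x \<alpha> i) + scale (lam * of_nat i) (lowered x \<alpha> i)"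
      using nov_basis[OF that zero_in, of "i - 1" 1]
      by (cases i) (simp_all add: lowered_def scale_right_distrib mult.commute)
    have "scale b (br one (x \<alpha> (Suc i))) + br one (x \<alpha> i) =
        nov (br one (x \<alpha> i)) (x 0 1) + nov (x \<alpha> i) (br one (x 0 1))"
      using br_one_nov[of "x \<alpha> i" "x 0 1"] by (simp only: up br.add_right br.scale_right)
    also have "\<dots> = scale (\<phi> \<alpha>) (scale b (x \<alpha> (Suc i)) + x \<alpha> i)
        + scale (lam * of_nat i) (nov (lowered x \<alpha> i) (x 0 1)) + scale (b * lam) (x \<alpha> i)"
      by (simp only: Suc.IH x01 add_left scale_left scale_right nov_one up) (simp add: mult.commute)
    also have "\<dots> = scale b (scale (\<phi> \<alpha>) (x \<alpha> (Suc i)) + scale (lam * of_nat (Suc i)) (x \<alpha> i))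
        + br one (x \<alpha> i)"
      unfolding low Suc.IH
      by (simp add: scale_right_distrib scale_left_distrib distrib_left mult.commute)
    finally have "scale b (br one (x \<alpha> (Suc i))) =
        scale b (scale (\<phi> \<alpha>) (x \<alpha> (Suc i)) + scale (lam * of_nat (Suc i)) (x \<alpha> i))"
      by simp
    then show ?case using b_nonzero by (simp add: lowered_def)
  qed
qed

end

end

section \<open>The classification of the brackets\<close>

theorem theorem5p1:
  fixes scale :: "complex \<Rightarrow> 'a::ab_group_add \<Rightarrow> 'a"
    and \<Delta> :: "complex set"
    and b :: complex
    and x :: "complex \<Rightarrow> nat \<Rightarrow> 'a"
    and nov br :: "'a \<Rightarrow> 'a \<Rightarrow> 'a"
  assumes "additive_subgroup \<Delta>"
    and "b \<notin> \<Delta>"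
    and "indexed_basis scale \<Delta> x"
    and "bilinear_op scale nov"
    and "\<forall>\<alpha>\<in>\<Delta>. \<forall>\<beta>\<in>\<Delta>. \<forall>i j. nov (x \<alpha> i) (x \<beta> j) =
           scale (\<beta> + b) (x (\<alpha> + \<beta>) (i + j)) + scale (of_nat j) (lowered x (\<alpha> + \<beta>) (i + j))"
    and "bilinear_op scale br"
  shows "lie_algebra_over_novikov scale nov br \<longleftrightarrow>
    (\<exists>\<phi> lam. additive_hom_on \<Delta> \<phi> \<and>
      (\<forall>\<alpha>\<in>\<Delta>. \<forall>\<beta>\<in>\<Delta>. \<forall>i j. br (x \<alpha> i) (x \<beta> j) =
         scale (1 / b * ((\<alpha> + b) * \<phi> \<beta> - (\<beta> + b) * \<phi> \<alpha>)) (x (\<alpha> + \<beta>) (i + j))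
         + scale (1 / b * (of_nat i * (\<phi> \<beta> - lam * (\<beta> + b)) + of_nat j * (lam * (\<alpha> + b) - \<phi> \<alpha>)))
             (lowered x (\<alpha> + \<beta>) (i + j))))"
proof -
  interpret truncated_exponential_novikov scale nov \<Delta> b x
    by (intro truncated_exponential_novikov.intro bilinear_product.intro bilinear_product_axioms.intro
        truncated_exponential_novikov_axioms.intro)
      (use assms in \<open>auto simp: indexed_basis_def\<close>)
  show ?thesis (is "?L \<longleftrightarrow> ?R")
  proof
    assume ?L
    then have gd: "gelfand_dorfman_bialgebra scale br nov" by (simp add: lie_algebra_over_novikov_def)
    have lin: "Vector_Spaces.linear scale scale (br (x 0 0))"
      using assms(6) by (simp add: bilinear_op_def)
    show ?R
      \<comment> \<open>The witnesses are the coordinates from \<open>br_one_basis\<close>. Folding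
        replaces the derivation bracket of \<open>br one\<close> by \<open>br\<close>.\<close>
      using br_one_basis(1)[OF gd]
        derivation_bracket_basis[OF lin br_one_basis[OF gd], folded bracket_eq_derivation_bracket[OF gd]]
      by blast
  next
    assume ?R
    then show ?L
      unfolding lie_algebra_over_novikov_def
      using gelfand_dorfman_if_basis[OF assms(6)] by blast
  qed
qed

end
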